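(* None of the following two-dimensional complex evolution algebras with natural basis $\{e_1,e_2\}$ (where $e_1e_2=e_2e_1=0$) satisfies the condition $P$: \begin{itemize} \item $E_2:\ e_1e_1=e_1,\ e_2e_2=e_1$; \item $E_3:\ e_1e_1=e_1+e_2,\ e_2e_2=-e_1-e_2$; \item $E_5=E_5(a_2,a_3):\ e_1e_1=e_1+a_2e_2,\ e_2e_2=a_3e_1+e_2$, for any $a_2,a_3\in\mathbb{C}$ with $1-a_2a_3\neq 0$; \item $E_6=E_6(a_4):\ e_1e_1=e_2,\ e_2e_2=e_1+a_4e_2$, for any $a_4\in\mathbb{C}$. \end{itemize}
   Context: All algebras are finite dimensional over $\mathbb{C}$ (not necessarily associative). An evolution algebra is an algebra $E$ admitting a basis $\{e_1,\dots,e_n\}$ (called a natural basis) with $e_i\cdot e_j=0$ for $i\ne j$. A natural basis of $E$ is any vector space basis whose distinct elements multiply to zero. Condition $P$: an evolution algebra $E$ satisfies the condition $P$ if every subalgebra $M$ of $E$ (linear subspace closed under multiplication) has a basis consisting of elements with pairwise zero products (a natural basis of $M$) which can be extended to a natural basis of $E$. *)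

theory Defs
  imports "HOL-Analysis.Cartesian_Space"
begin

text \<open>
  The algebra lives on the whole type \<open>'a\<close>; its product \<open>mul\<close> is only required to be bilinear
  (no associativity, commutativity or unit).
\<close>

locale complex_algebra = vector_space scale
  for scale :: "complex \<Rightarrow> 'a::ab_group_add \<Rightarrow> 'a" +
  fixes mul :: "'a \<Rightarrow> 'a \<Rightarrow> 'a"
  assumes linear_mul_left: "\<And>y. Vector_Spaces.linear scale scale (\<lambda>x. mul x y)"
    and linear_mul_right: "\<And>x. Vector_Spaces.linear scale scale (\<lambda>y. mul x y)"
    and finite_dim: "\<exists>B. finite B \<and> span B = UNIV"
begin

definition subalgebra :: "'a set \<Rightarrow> bool" where
  "subalgebra M \<longleftrightarrow> subspace M \<and> (\<forall>x\<in>M. \<forall>y\<in>M. mul x y \<in> M)"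

definition natural_basis_of :: "'a set \<Rightarrow> 'a set \<Rightarrow> bool" where
  "natural_basis_of M B \<longleftrightarrow>
     independent B \<and> span B = M \<and> (\<forall>x\<in>B. \<forall>y\<in>B. x \<noteq> y \<longrightarrow> mul x y = 0)"

abbreviation natural_basis :: "'a set \<Rightarrow> bool" where
  "natural_basis B \<equiv> natural_basis_of UNIV B"

end

locale evolution_algebra = complex_algebra +
  assumes ex_natural_basis: "\<exists>B. natural_basis B"
begin

definition condition_P :: bool where
  "condition_P \<longleftrightarrow>
     (\<forall>M. subalgebra M \<longrightarrow>
       (\<exists>B C. natural_basis_of M B \<and> B \<subseteq> C \<and> natural_basis C))"

end

text \<open>Every two-dimensional multiplication table is realised by an evolution algebra on \<open>\<complex>\<^sup>2\<close>.\<close>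

definition table_mul ::
  "complex^2 \<Rightarrow> complex^2 \<Rightarrow> complex^2 \<Rightarrow> complex^2 \<Rightarrow> complex^2" where
  "table_mul u v x y = (x$1 * y$1) *s u + (x$2 * y$2) *s v"

lemma evolution_algebra_table_mul:
  fixes u v :: "complex^2"
  defines "e1 \<equiv> axis 1 1" and "e2 \<equiv> axis 2 1"
  shows "evolution_algebra (*s) (table_mul u v)" (is ?A)
    and "complex_algebra.natural_basis_of (*s) (table_mul u v) UNIV {e1, e2}" (is ?B)
    and "e1 \<noteq> e2"
    and "table_mul u v e1 e1 = u" and "table_mul u v e2 e2 = v"
proof -
  have cart: "cart_basis = {e1, e2}"
    unfolding cart_basis_def e1_def e2_def by (auto simp: UNIV_2)
  interpret complex_algebra "(*s)" "table_mul u v"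
  proof
    show "\<exists>B. finite B \<and> vec.span B = (UNIV :: (complex^2) set)"
      using finite_cart_basis span_cart_basis by blast
  qed (simp_all add: table_mul_def vec_eq_iff algebra_simps)
  have "vec.independent {e1, e2}" "vec.span {e1, e2} = UNIV"
    by (simp_all flip: cart add: independent_cart_basis span_cart_basis)
  moreover have "table_mul u v e1 e2 = 0" "table_mul u v e2 e1 = 0"
    by (simp_all add: table_mul_def e1_def e2_def axis_def)
  ultimately show B: ?B
    unfolding natural_basis_of_def by auto
  show ?A
    by unfold_locales (use B in blast)
  show "e1 \<noteq> e2"
    by (simp add: e1_def e2_def axis_eq_axis)
  show "table_mul u v e1 e1 = u" "table_mul u v e2 e2 = v"
    by (simp_all add: table_mul_def e1_def e2_def axis_def vec_eq_iff)
qed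

end

theory Submission
  imports Defs "HOL-Computational_Algebra.Fundamental_Theorem_Algebra"
begin

text \<open>
  In each algebra there is a line \<open>span {u}\<close> with \<open>u = e1 + t e2\<close> and \<open>t \<noteq> 0\<close> which is a
  subalgebra, yet no natural basis contains a nonzero vector of this line.  Condition \<open>P\<close> would
  supply such a natural basis, hence a vector \<open>w = p e1 + q e2\<close> off the line with
  \<open>u w = p e1\<^sup>2 + t q e2\<^sup>2 = 0\<close> (lemma \<open>condition_P_annihilator_coordinates\<close>).

  In \<open>E\<^sub>5\<close> and \<open>E\<^sub>6\<close> the squares \<open>e1\<^sup>2\<close> and \<open>e2\<^sup>2\<close> are linearly independent, so
  \<open>u w = 0\<close> forces \<open>p = t q = 0\<close> and therefore \<open>w = 0\<close>; up to scaling, \<open>e1\<close> and \<open>e2\<close> are the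
  only vectors that occur in a natural basis.  It remains to find a subalgebra spanned by some
  \<open>e1 + t e2\<close> with \<open>t \<noteq> 0\<close>.  That \<open>u\<^sup>2\<close> is proportional to \<open>u\<close> is a polynomial equation in \<open>t\<close>,
  and a nonzero root exists because \<open>\<complex>\<close> is algebraically closed.

  In \<open>E\<^sub>2\<close> and \<open>E\<^sub>3\<close> the squares are proportional and the product is a scalar product
  with values in a line; for it, the vector \<open>u = e1 + \<i> e2\<close>, respectively \<open>u = e1 + e2\<close>, is
  isotropic.  As the scalar product is nondegenerate on a plane, the orthogonal complement of
  \<open>u\<close> is the line through \<open>u\<close> itself, which leaves no room for \<open>w\<close>.
\<close>

section \<open>Coordinates in a two-element natural basis\<close>

context complex_algebra
begin

lemma mul_add_left: "mul (x + y) z = mul x z + mul y z"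
  and mul_scale_left: "mul (scale c x) z = scale c (mul x z)"
  and mul_add_right: "mul z (x + y) = mul z x + mul z y"
  and mul_scale_right: "mul z (scale c x) = scale c (mul z x)"
  using linear_mul_left[of z] linear_mul_right[of z]
  by (simp_all add: Vector_Spaces.linear_iff)

lemma subalgebra_span_singleton:
  assumes "mul u u \<in> span {u}"
  shows "subalgebra (span {u})"
proof -
  have "mul x y \<in> span {u}" if x: "x \<in> span {u}" and y: "y \<in> span {u}" for x y
  proof -
    obtain a b where "x = scale a u" and "y = scale b u"
      using x y by (auto simp: span_singleton)
    then show ?thesis
      using assms by (simp add: mul_scale_left mul_scale_right span_scale)
  qed
  then show ?thesis
    by (simp add: subalgebra_def)
qed

lemma natural_basis_mul_eq_0:
  assumes "natural_basis {e1, e2}" and "e1 \<noteq> e2"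
  shows "mul e1 e2 = 0" and "mul e2 e1 = 0"
  using assms by (auto simp: natural_basis_of_def)

lemma mul_coordinates:
  assumes "natural_basis {e1, e2}" and "e1 \<noteq> e2"
  shows "mul (scale a e1 + scale b e2) (scale c e1 + scale d e2)
    = scale (a * c) (mul e1 e1) + scale (b * d) (mul e2 e2)"
  by (simp add: mul_add_left mul_add_right mul_scale_left mul_scale_right
      natural_basis_mul_eq_0[OF assms] mult.commute)

lemma natural_basis_coordinates:
  assumes "natural_basis {e1, e2}"
  obtains p q where "w = scale p e1 + scale q e2"
proof -
  have "w \<in> span {e1, e2}"
    using assms by (simp add: natural_basis_of_def)
  then obtain p q where "w - scale p e1 = scale q e2"
    by (auto simp: span_insert span_singleton)
  then have "w = scale p e1 + scale q e2"
    by (simp add: algebra_simps)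
  then show thesis
    by (rule that)
qed

lemma natural_basis_coordinates_eq_0:
  assumes "natural_basis {e1, e2}" and "e1 \<noteq> e2" and "scale a e1 + scale b e2 = 0"
  shows "a = 0" and "b = 0"
proof -
  have "independent {e1, e2}"
    using assms(1) by (simp add: natural_basis_of_def)
  then have nin: "e1 \<notin> span {e2}" "e2 \<noteq> 0"
    using \<open>e1 \<noteq> e2\<close> by (auto simp: independent_insert)
  show "a = 0"
  proof (rule ccontr)
    assume "a \<noteq> 0"
    have "scale a e1 = scale (- b) e2"
      using assms(3) by (simp add: eq_neg_iff_add_eq_0)
    then have "scale (1 / a) (scale a e1) = scale (1 / a) (scale (- b) e2)"
      by simp
    then have "e1 = scale (- b / a) e2"
      using \<open>a \<noteq> 0\<close> by simp
    then show False
      using nin(1) span_scale[OF span_base[of e2 "{e2}"], of "- b / a"] by simp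
  qed
  then show "b = 0"
    using assms(3) nin(2) by simp
qed

end

section \<open>Annihilators forced by condition P\<close>

context evolution_algebra
begin

text \<open>
  A natural basis of the line \<open>span {u}\<close> consists of a nonzero multiple of \<open>u\<close>.  When it is extended to a
  natural basis of a larger algebra, the extension has an element off the line, and this
  element annihilates \<open>u\<close>.
\<close>

lemma condition_P_imp_annihilator:
  assumes "condition_P" and "mul u u \<in> span {u}" and "u \<noteq> 0" and "span {u} \<noteq> UNIV"
  obtains w where "w \<notin> span {u}" and "mul u w = 0"
proof -
  obtain B C where B: "natural_basis_of (span {u}) B" and "B \<subseteq> C" and C: "natural_basis C"
    using assms(1) subalgebra_span_singleton[OF assms(2)] unfolding condition_P_def by blast
  have "B \<noteq> {}"
    using B assms(3) span_base[of u "{u}"] by (auto simp: natural_basis_of_def)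
  then obtain b where "b \<in> B"
    by blast
  then have "b \<in> span {u}" and "b \<noteq> 0"
    using B dependent_zero span_base by (auto simp: natural_basis_of_def)
  then obtain k where b: "b = scale k u" and "k \<noteq> 0"
    by (auto simp: span_singleton)
  have "\<not> C \<subseteq> span {u}"
    using C assms(4) span_mono[of C "span {u}"] by (auto simp: natural_basis_of_def span_span)
  then obtain w where "w \<in> C" and w: "w \<notin> span {u}"
    by blast
  have "mul b w = 0"
    using C \<open>b \<in> B\<close> \<open>B \<subseteq> C\<close> \<open>w \<in> C\<close> w \<open>b \<in> span {u}\<close>
    by (auto simp: natural_basis_of_def)
  then have "mul u w = 0"
    using \<open>k \<noteq> 0\<close> by (simp add: b mul_scale_left)
  with w show thesis
    by (rule that)
qed

text \<open>
  The hypothesis \<open>sq\<close> says that \<open>u\<^sup>2 = c u\<close> for \<open>u = e1 + t e2\<close>, so that \<open>u\<close> spans a subalgebra;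
  the conclusion \<open>q \<noteq> t p\<close> says that \<open>w = p e1 + q e2\<close> lies off the line through \<open>u\<close>, and the last
  equation is \<open>u w = 0\<close>.
\<close>

lemma condition_P_annihilator_coordinates:
  assumes "condition_P" and nb: "natural_basis {e1, e2}" and ne: "e1 \<noteq> e2"
    and sq: "mul e1 e1 + scale (t\<^sup>2) (mul e2 e2) = scale c (e1 + scale t e2)"
  obtains p q where "q \<noteq> t * p" and "scale p (mul e1 e1) + scale (t * q) (mul e2 e2) = 0"
proof -
  let ?u = "scale 1 e1 + scale t e2"
  have "mul ?u ?u = scale c ?u"
    unfolding mul_coordinates[OF nb ne] using sq by (simp add: power2_eq_square)
  then have "mul ?u ?u \<in> span {?u}"
    by (auto simp: span_singleton)
  moreover have "?u \<noteq> 0"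
  proof
    assume "?u = 0"
    then have "(1::complex) = 0"
      by (rule natural_basis_coordinates_eq_0(1)[OF nb ne])
    then show False
      by simp
  qed
  moreover have "e2 \<notin> span {?u}"
  proof
    assume "e2 \<in> span {?u}"
    then obtain k where k: "e2 = scale k ?u"
      by (auto simp: span_singleton)
    then have "scale k e1 + scale (k * t - 1) e2 = 0"
      by (simp add: algebra_simps)
    then have "k = 0" and "k * t - 1 = 0"
      using natural_basis_coordinates_eq_0[OF nb ne] by blast+
    then show False
      by simp
  qed
  ultimately obtain w where w: "w \<notin> span {?u}" "mul ?u w = 0"
    using condition_P_imp_annihilator[OF assms(1)] by blast
  obtain p q where pq: "w = scale p e1 + scale q e2"
    using natural_basis_coordinates[OF nb] .
  have "q \<noteq> t * p"
  proof
    assume "q = t * p"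
    then have "w = scale p ?u"
      by (simp add: pq algebra_simps)
    then show False
      using w(1) by (auto simp: span_singleton)
  qed
  moreover have "scale p (mul e1 e1) + scale (t * q) (mul e2 e2) = 0"
    using w(2) unfolding pq mul_coordinates[OF nb ne] by simp
  ultimately show thesis
    by (rule that)
qed

text \<open>
  Linear independence of the two squares, in the form needed here, says that the algebra is
  perfect, that is, equal to its square.  A product \<open>u w\<close> can then vanish only if \<open>u\<close> and \<open>w\<close> have
  disjoint supports in the basis \<open>{e1, e2}\<close>; since \<open>t \<noteq> 0\<close> gives \<open>u = e1 + t e2\<close> full support, \<open>u\<close>
  has no nonzero annihilator.
\<close>

lemma not_condition_P_if_independent_squares:
  assumes nb: "natural_basis {e1, e2}" and ne: "e1 \<noteq> e2"
    and indep: "\<And>a b. scale a (mul e1 e1) + scale b (mul e2 e2) = 0 \<Longrightarrow> a = 0 \<and> b = 0"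
    and "t \<noteq> 0"
    and sq: "mul e1 e1 + scale (t\<^sup>2) (mul e2 e2) = scale c (e1 + scale t e2)"
  shows "\<not> condition_P"
proof
  assume "condition_P"
  then obtain p q where "q \<noteq> t * p" "scale p (mul e1 e1) + scale (t * q) (mul e2 e2) = 0"
    using condition_P_annihilator_coordinates[OF _ nb ne sq] by blast
  then show False
    using indep[of p "t * q"] \<open>t \<noteq> 0\<close> by simp
qed

end

section \<open>Isotropic lines in the algebras with proportional squares\<close>

context evolution_algebra
begin

lemma not_condition_P_E2:
  assumes nb: "natural_basis {e1, e2}" and ne: "e1 \<noteq> e2"
    and m: "mul e1 e1 = e1" "mul e2 e2 = e1"
  shows "\<not> condition_P"
proof
  assume P: "condition_P"
  have "mul e1 e1 + scale (\<i>\<^sup>2) (mul e2 e2) = scale 0 (e1 + scale \<i> e2)"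
    by (simp add: m)
  then obtain p q where pq: "q \<noteq> \<i> * p"
      "scale p (mul e1 e1) + scale (\<i> * q) (mul e2 e2) = 0"
    using condition_P_annihilator_coordinates[OF P nb ne] by blast
  then have "scale (p + \<i> * q) e1 + scale 0 e2 = 0"
    by (simp add: m scale_left_distrib)
  then have "p + \<i> * q = 0"
    using natural_basis_coordinates_eq_0(1)[OF nb ne] by blast
  then have "\<i> * (p + \<i> * q) = 0"
    by simp
  then have "q = \<i> * p"
    by (simp add: algebra_simps)
  then show False
    using pq(1) by simp
qed

lemma not_condition_P_E3:
  assumes nb: "natural_basis {e1, e2}" and ne: "e1 \<noteq> e2"
    and m: "mul e1 e1 = e1 + e2" "mul e2 e2 = - e1 - e2"
  shows "\<not> condition_P"
proof
  assume P: "condition_P"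
  have "mul e1 e1 + scale (1\<^sup>2) (mul e2 e2) = scale 0 (e1 + scale 1 e2)"
    by (simp add: m)
  then obtain p q where pq: "q \<noteq> 1 * p"
      "scale p (mul e1 e1) + scale (1 * q) (mul e2 e2) = 0"
    using condition_P_annihilator_coordinates[OF P nb ne] by blast
  then have "scale (p - q) e1 + scale (p - q) e2 = 0"
    by (simp add: m algebra_simps)
  then have "p - q = 0"
    using natural_basis_coordinates_eq_0(1)[OF nb ne] by blast
  then show False
    using pq(1) by simp
qed

end

section \<open>One-dimensional subalgebras of the perfect algebras\<close>

text \<open>
  The roots of this cubic are the slopes \<open>t\<close> for which \<open>e1 + t e2\<close> spans a subalgebra of \<open>E\<^sub>5\<close>.
  For \<open>a2 = 0\<close> the slope \<open>0\<close> of the line through the idempotent \<open>e1\<close> has to be divided out.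
\<close>

lemma E5_nonzero_slope:
  fixes a2 a3 :: complex
  obtains t where "t \<noteq> 0" and "a2 + t\<^sup>2 = (1 + t\<^sup>2 * a3) * t"
proof (cases "a2 = 0")
  case True
  have "\<not> constant (poly [:1, - 1, a3:])"
    by (simp add: constant_degree)
  then obtain t where t: "poly [:1, - 1, a3:] t = 0"
    using fundamental_theorem_of_algebra by blast
  then have "t \<noteq> 0"
    by auto
  have "a2 + t\<^sup>2 - (1 + t\<^sup>2 * a3) * t = - t * poly [:1, - 1, a3:] t"
    by (simp add: True algebra_simps power2_eq_square)
  then have "a2 + t\<^sup>2 - (1 + t\<^sup>2 * a3) * t = 0"
    by (simp only: t mult_zero_right minus_zero)
  with \<open>t \<noteq> 0\<close> show thesis
    using that by (simp only: right_minus_eq)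
next
  case False
  have "\<not> constant (poly [:- a2, 1, - 1, a3:])"
    by (simp add: constant_degree)
  then obtain t where t: "poly [:- a2, 1, - 1, a3:] t = 0"
    using fundamental_theorem_of_algebra by blast
  then have "t \<noteq> 0"
    using False by auto
  have "a2 + t\<^sup>2 - (1 + t\<^sup>2 * a3) * t = - poly [:- a2, 1, - 1, a3:] t"
    by (simp add: algebra_simps power2_eq_square)
  then have "a2 + t\<^sup>2 - (1 + t\<^sup>2 * a3) * t = 0"
    by (simp only: t mult_zero_right minus_zero)
  with \<open>t \<noteq> 0\<close> show thesis
    using that by (simp only: right_minus_eq)
qed

text \<open>
  The cubic for the slopes of the one-dimensional subalgebras of \<open>E\<^sub>6\<close> has constant coefficient
  \<open>1\<close>, so none of its roots is \<open>0\<close>.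
\<close>

lemma E6_nonzero_slope:
  fixes a4 :: complex
  obtains t where "t \<noteq> 0" and "1 + t\<^sup>2 * a4 = t\<^sup>2 * t"
proof -
  have "\<not> constant (poly [:1, 0, a4, - 1:])"
    by (simp add: constant_degree)
  then obtain t where t: "poly [:1, 0, a4, - 1:] t = 0"
    using fundamental_theorem_of_algebra by blast
  then have "t \<noteq> 0"
    by auto
  have "1 + t\<^sup>2 * a4 - t\<^sup>2 * t = poly [:1, 0, a4, - 1:] t"
    by (simp add: algebra_simps power2_eq_square)
  then have "1 + t\<^sup>2 * a4 - t\<^sup>2 * t = 0"
    by (simp only: t mult_zero_right minus_zero)
  with \<open>t \<noteq> 0\<close> show thesis
    using that by (simp only: right_minus_eq)
qed

context evolution_algebra
begin

lemma not_condition_P_E5: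
  assumes nb: "natural_basis {e1, e2}" and ne: "e1 \<noteq> e2" and det: "1 - a2 * a3 \<noteq> 0"
    and m: "mul e1 e1 = e1 + scale a2 e2" "mul e2 e2 = scale a3 e1 + e2"
  shows "\<not> condition_P"
proof -
  have indep: "a = 0 \<and> b = 0" if "scale a (mul e1 e1) + scale b (mul e2 e2) = 0" for a b
  proof -
    have "scale (a + b * a3) e1 + scale (a * a2 + b) e2 = 0"
      using that by (simp add: m algebra_simps)
    then have "a + b * a3 = 0" and "a * a2 + b = 0"
      using natural_basis_coordinates_eq_0[OF nb ne] by blast+
    then have "b = - (a * a2)" and "a * (1 - a2 * a3) = 0"
      by algebra+
    then show ?thesis
      using det by simp
  qed
  obtain t where t: "t \<noteq> 0" "a2 + t\<^sup>2 = (1 + t\<^sup>2 * a3) * t"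
    using E5_nonzero_slope .
  have "mul e1 e1 + scale (t\<^sup>2) (mul e2 e2)
      = scale (1 + t\<^sup>2 * a3) e1 + scale (a2 + t\<^sup>2) e2"
    by (simp add: m algebra_simps)
  also have "\<dots> = scale (1 + t\<^sup>2 * a3) (e1 + scale t e2)"
    by (simp only: t(2) scale_right_distrib scale_scale)
  finally show ?thesis
    using not_condition_P_if_independent_squares[OF nb ne indep t(1)] by blast
qed

lemma not_condition_P_E6:
  assumes nb: "natural_basis {e1, e2}" and ne: "e1 \<noteq> e2"
    and m: "mul e1 e1 = e2" "mul e2 e2 = e1 + scale a4 e2"
  shows "\<not> condition_P"
proof -
  have indep: "a = 0 \<and> b = 0" if "scale a (mul e1 e1) + scale b (mul e2 e2) = 0" for a b
  proof -
    have "scale b e1 + scale (a + b * a4) e2 = 0"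
      using that by (simp add: m algebra_simps)
    then have "b = 0" and "a + b * a4 = 0"
      using natural_basis_coordinates_eq_0[OF nb ne] by blast+
    then show ?thesis
      by simp
  qed
  obtain t where t: "t \<noteq> 0" "1 + t\<^sup>2 * a4 = t\<^sup>2 * t"
    using E6_nonzero_slope .
  have "mul e1 e1 + scale (t\<^sup>2) (mul e2 e2) = scale (t\<^sup>2) e1 + scale (1 + t\<^sup>2 * a4) e2"
    by (simp add: m algebra_simps)
  also have "\<dots> = scale (t\<^sup>2) (e1 + scale t e2)"
    by (simp only: t(2) scale_right_distrib scale_scale)
  finally show ?thesis
    using not_condition_P_if_independent_squares[OF nb ne indep t(1)] by blast
qed

end

section \<open>The four families\<close>

theorem proposition3p2:
  fixes scale :: "complex \<Rightarrow> 'a::ab_group_add \<Rightarrow> 'a"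
    and mul :: "'a \<Rightarrow> 'a \<Rightarrow> 'a"
    and e1 e2 :: 'a
  assumes "evolution_algebra scale mul"
    and "complex_algebra.natural_basis_of scale mul UNIV {e1, e2}"
    and "e1 \<noteq> e2"
  shows "(mul e1 e1 = e1 \<and> mul e2 e2 = e1 \<longrightarrow>
            \<not> evolution_algebra.condition_P scale mul) \<and>
         (mul e1 e1 = e1 + e2 \<and> mul e2 e2 = - e1 - e2 \<longrightarrow>
            \<not> evolution_algebra.condition_P scale mul) \<and>
         (\<forall>a2 a3 :: complex. 1 - a2 * a3 \<noteq> 0 \<longrightarrow>
            mul e1 e1 = e1 + scale a2 e2 \<and> mul e2 e2 = scale a3 e1 + e2 \<longrightarrow>
            \<not> evolution_algebra.condition_P scale mul) \<and>
         (\<forall>a4 :: complex.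
            mul e1 e1 = e2 \<and> mul e2 e2 = e1 + scale a4 e2 \<longrightarrow>
            \<not> evolution_algebra.condition_P scale mul)"
proof -
  interpret evolution_algebra scale mul
    by (rule assms(1))
  note nb = assms(2,3)
  show ?thesis
    using not_condition_P_E2[OF nb] not_condition_P_E3[OF nb]
      not_condition_P_E5[OF nb] not_condition_P_E6[OF nb]
    by blast
qed

end
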